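(* Let $d\ge 1$ and let $S$ be the unit $d$-sphere in $\mathbb R^{d+1}$ centered at the origin. Let $\mathcal F$ be a non-separable collection of $n\ge 1$ caps on $S$ of spherical radii $\alpha_1,\dots,\alpha_n>0$. If $\alpha_1+\dots+\alpha_n<\pi/2$, then there is a cap of spherical radius $\alpha_1+\dots+\alpha_n$ on $S$ that contains every cap of $\mathcal F$.
   Context: The spherical distance on $S$ is the angular distance: for $\mathbf x,\mathbf y\in S$ it is $\arccos\langle \mathbf x,\mathbf y\rangle\in[0,\pi]$. A cap of spherical radius $\alpha$ on $S$ is the set of all points of $S$ within spherical distance $\alpha$ from (i.e. at spherical distance at most $\alpha$ from) a given point of $S$, called its center. A great sphere is the intersection of $S$ with a hyperplane (a $d$-dimensional linear subspace of $\mathbb R^{d+1}$) passing through the origin. A great sphere is called avoiding for a collection of caps if it does not intersect any cap in the collection. A finite collection of caps is called non-separable if no avoiding great sphere divides the collection into two non-empty sets, i.e. there is no avoiding great sphere such that at least one cap of the collection lies in each of the two open hemispheres it bounds. *)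

theory Defs
  imports "HOL-Analysis.Analysis"
begin

text \<open>The unit sphere of dimension \<open>d\<close> is \<^term>\<open>sphere 0 1\<close> in a Euclidean space of
  dimension \<open>d + 1\<close>.\<close>

definition spherical_dist :: "'a::euclidean_space \<Rightarrow> 'a \<Rightarrow> real" where
  "spherical_dist x y = arccos (x \<bullet> y)"

definition is_cap :: "real \<Rightarrow> 'a::euclidean_space set \<Rightarrow> bool" where
  "is_cap \<alpha> C \<longleftrightarrow> (\<exists>c \<in> sphere 0 1. C = {x \<in> sphere 0 1. spherical_dist c x \<le> \<alpha>})"

definition great_sphere :: "'a::euclidean_space set \<Rightarrow> bool" where
  "great_sphere G \<longleftrightarrow>
     (\<exists>H. subspace H \<and> dim H + 1 = DIM('a) \<and> G = H \<inter> sphere 0 1)"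

definition avoiding :: "'a::euclidean_space set \<Rightarrow> 'a set set \<Rightarrow> bool" where
  "avoiding G F \<longleftrightarrow> great_sphere G \<and> (\<forall>C\<in>F. G \<inter> C = {})"

text \<open>If \<open>DIM('a) \<ge> 2\<close>, a great sphere determines its normal vector \<open>u\<close> up to a nonzero
  scalar, so the unordered pair of open hemispheres \<open>A\<close> and \<open>B\<close> is determined by \<open>G\<close>.\<close>

definition open_hemispheres_bounded_by ::
    "'a::euclidean_space set \<Rightarrow> 'a set \<Rightarrow> 'a set \<Rightarrow> bool" where
  "open_hemispheres_bounded_by G A B \<longleftrightarrow>
     (\<exists>u. u \<noteq> 0 \<and> G = {x \<in> sphere 0 1. u \<bullet> x = 0}
        \<and> A = {x \<in> sphere 0 1. u \<bullet> x > 0} \<and> B = {x \<in> sphere 0 1. u \<bullet> x < 0})"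

definition non_separable :: "'a::euclidean_space set set \<Rightarrow> bool" where
  "non_separable F \<longleftrightarrow> finite F \<and>
     \<not> (\<exists>G A B. avoiding G F \<and> open_hemispheres_bounded_by G A B
          \<and> (\<exists>C\<in>F. C \<subseteq> A) \<and> (\<exists>C\<in>F. C \<subseteq> B))"

end

theory Submission
  imports Defs
begin

text \<open>
  Let \<open>v\<^sub>i\<close> be the centers and \<open>\<alpha>\<^sub>i\<close> the radii, \<open>A = \<Sum> \<alpha>\<^sub>i\<close>, and \<open>w\<^sub>i = sin \<alpha>\<^sub>i v\<^sub>i\<close>. The great
  sphere orthogonal to a unit vector \<open>u\<close> avoids the \<open>i\<close>-th cap exactly when
  \<open>\<bar>u \<bullet> v\<^sub>i\<bar> > sin \<alpha>\<^sub>i\<close>, and the sign of \<open>u \<bullet> v\<^sub>i\<close> then tells the hemisphere of that cap.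
  Non-separability says that avoiding vectors \<open>u\<close> give the same sign to all caps. The proof is
  about the signed sums \<open>x = \<Sum> \<plusminus>w\<^sub>i\<close> (\<open>signed_sum\<close>) and goes by induction on the number of
  caps.

  Suppose first that all signed sums have norm at most \<open>sin A\<close>. Then the cap of radius \<open>A\<close>
  around the direction of \<open>y = \<Sum> w\<^sub>i\<close> works (\<open>cap_around_sum\<close>). Bang's argument shows that
  if \<open>x + z\<close> is a longest vector among all signed sums translated by a fixed \<open>z\<close>, and its
  norm is below \<open>1\<close>, then it avoids all caps, with the signs of \<open>x\<close> (\<open>bang_offset\<close>). For
  \<open>z = 0\<close> the longest sum may be \<open>\<plusminus>y\<close>, whose signs are constant. A translation \<open>z\<close>
  orthogonal to \<open>y\<close> treats \<open>y\<close> and \<open>-y\<close> alike and can favour a sum with mixed signs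
  instead; there is room for this as long as \<open>\<bar>z\<bar> < cos A\<close>, because then
  \<open>\<bar>y\<bar>\<^sup>2 + \<bar>z\<bar>\<^sup>2 < sin\<^sup>2 A + cos\<^sup>2 A = 1\<close>. If a cap \<open>i\<close> sticks out of the proposed cap, the
  sum \<open>y - 2 w\<^sub>i\<close> is so far from the line through \<open>y\<close> that such a translation exists, and the
  caps are separated.

  Suppose now that some signed sum is longer than \<open>sin A\<close>. Take a smallest subfamily \<open>I\<close> that
  has a signed sum longer than \<open>sin (\<Sum>\<^sub>I \<alpha>\<^sub>i)\<close>. The cap of radius \<open>\<Sum>\<^sub>I \<alpha>\<^sub>i\<close> around the
  direction of this sum contains every cap of \<open>I\<close>, up to replacing it by its antipode according
  to its sign (\<open>minimal_long_sum_cap\<close>). Replacing \<open>I\<close> by this single cap keeps the family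
  non-separable and preserves the total radius, so the induction hypothesis gives a cap of radius
  \<open>A\<close> around some \<open>p\<close> that contains the new family. Since \<open>A < \<pi>/2\<close>, the great sphere
  orthogonal to \<open>p\<close> avoids the new family and hence the old one. By non-separability all signs
  on \<open>I\<close> are then equal, so no cap was reflected and the old family is covered as well
  (\<open>nonseparable_centers_cap\<close>).
\<close>

section \<open>Angles between unit vectors\<close>

lemma inner_unit_bounds:
  fixes p q :: "'a::real_inner"
  assumes "norm p = 1" "norm q = 1"
  shows "- 1 \<le> p \<bullet> q" "p \<bullet> q \<le> 1"
  using Cauchy_Schwarz_ineq2[of p q] assms by auto

lemma norm_orthogonal_part:
  fixes p q :: "'a::real_inner"
  assumes "norm p = 1" "norm q = 1"
  shows "norm (q - (p \<bullet> q) *\<^sub>R p) = sqrt (1 - (p \<bullet> q)\<^sup>2)"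
proof -
  have "p \<bullet> p = 1" "q \<bullet> q = 1"
    using assms by (simp_all add: dot_square_norm)
  then have "(norm (q - (p \<bullet> q) *\<^sub>R p))\<^sup>2 = 1 - (p \<bullet> q)\<^sup>2"
    unfolding power2_norm_eq_inner
    by (simp add: algebra_simps inner_commute power2_eq_square)
  then show ?thesis
    by (metis norm_ge_zero real_sqrt_unique)
qed

lemma norm_mult_inner_sgn:
  fixes y w :: "'a::real_inner"
  shows "norm y * (sgn y \<bullet> w) = y \<bullet> w"
  by (cases "y = 0") (simp_all add: sgn_div_norm)

text \<open>Expanding \<open>p \<bullet> r\<close> along \<open>q\<close>, the Cauchy-Schwarz inequality for the parts orthogonal to \<open>q\<close>
  turns into the addition formula for the cosine.\<close>
lemma arccos_inner_triangle:
  fixes p q r :: "'a::real_inner"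
  assumes p: "norm p = 1" and q: "norm q = 1" and r: "norm r = 1"
  shows "arccos (p \<bullet> r) \<le> arccos (p \<bullet> q) + arccos (q \<bullet> r)"
proof (cases "arccos (p \<bullet> q) + arccos (q \<bullet> r) \<le> pi")
  case False
  then show ?thesis
    using arccos_ubound[OF inner_unit_bounds[OF p r]] by linarith
next
  case True
  note pq = inner_unit_bounds[OF p q] and qr = inner_unit_bounds[OF q r]
  let ?p' = "p - (q \<bullet> p) *\<^sub>R q" and ?r' = "r - (q \<bullet> r) *\<^sub>R q"
  have "q \<bullet> q = 1"
    using q by (simp add: dot_square_norm)
  then have split: "p \<bullet> r = (p \<bullet> q) * (q \<bullet> r) + ?p' \<bullet> ?r'"
    by (simp add: algebra_simps inner_commute)
  have "\<bar>?p' \<bullet> ?r'\<bar> \<le> norm ?p' * norm ?r'"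
    by (rule Cauchy_Schwarz_ineq2)
  also have "\<dots> = sqrt (1 - (p \<bullet> q)\<^sup>2) * sqrt (1 - (q \<bullet> r)\<^sup>2)"
    using norm_orthogonal_part[OF q p] norm_orthogonal_part[OF q r] by (simp add: inner_commute)
  finally have "cos (arccos (p \<bullet> q) + arccos (q \<bullet> r)) \<le> p \<bullet> r"
    using pq qr split by (simp add: cos_add sin_arccos)
  then have "arccos (p \<bullet> r) \<le> arccos (cos (arccos (p \<bullet> q) + arccos (q \<bullet> r)))"
    using inner_unit_bounds[OF p r] by (intro arccos_le_arccos) auto
  also have "\<dots> = arccos (p \<bullet> q) + arccos (q \<bullet> r)"
    using True arccos_lbound[OF pq] arccos_lbound[OF qr] by (intro arccos_cos) auto
  finally show ?thesis .
qed

text \<open>The hypothesis \<open>sub\<close> says that the cap of radius \<open>b\<close> around \<open>p\<close> contains the cap of radius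
  \<open>a\<close> around \<open>v\<close>. A great sphere avoiding the larger cap therefore avoids the smaller one and
  has it on the same side. The case \<open>a = 0\<close> is about points of a cap.\<close>
lemma avoid_larger_cap:
  fixes p v u :: "'a::real_inner"
  assumes p: "norm p = 1" and v: "norm v = 1"
    and sub: "arccos (p \<bullet> v) + a \<le> b" and a: "0 \<le> a" and b: "b < pi / 2"
    and u: "norm u * sin b < u \<bullet> p"
  shows "norm u * sin a < u \<bullet> v"
proof -
  have "u \<noteq> 0"
    using u by auto
  define e where "e = sgn u"
  have e: "norm e = 1" and ue: "u = norm u *\<^sub>R e"
    using \<open>u \<noteq> 0\<close> by (simp_all add: e_def norm_sgn sgn_div_norm)
  have ab: "a \<le> b"
    using sub arccos_lbound[OF inner_unit_bounds[OF p v]] by linarith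
  have "norm u * sin b < norm u * (e \<bullet> p)"
    using u ue by (metis inner_scaleR_left)
  then have "sin b < e \<bullet> p"
    using \<open>u \<noteq> 0\<close> by simp
  then have "cos (pi / 2 - b) < e \<bullet> p"
    by (simp add: cos_diff)
  then have "arccos (e \<bullet> p) < arccos (cos (pi / 2 - b))"
    using inner_unit_bounds[OF e p] by (intro arccos_less_arccos) auto
  also have "\<dots> = pi / 2 - b"
    using a ab b by (intro arccos_cos) auto
  finally have "arccos (e \<bullet> v) < pi / 2 - a"
    using arccos_inner_triangle[OF e p v] sub by linarith
  then have "cos (pi / 2 - a) < cos (arccos (e \<bullet> v))"
    using a arccos_lbound[OF inner_unit_bounds[OF e v]] by (intro cos_monotone_0_pi) auto
  then have "sin a < e \<bullet> v"
    using inner_unit_bounds[OF e v] by (simp add: cos_diff)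
  then have "norm u * sin a < norm u * (e \<bullet> v)"
    using \<open>u \<noteq> 0\<close> by simp
  then show ?thesis
    using ue by (metis inner_scaleR_left)
qed

section \<open>Signed sums and Bang's argument\<close>

definition sign_on :: "'i set \<Rightarrow> 'i \<Rightarrow> real" where
  "sign_on T i = (if i \<in> T then 1 else - 1)"

definition signed_sum ::
    "('i \<Rightarrow> 'a::real_inner) \<Rightarrow> ('i \<Rightarrow> real) \<Rightarrow> 'i set \<Rightarrow> 'i set \<Rightarrow> 'a" where
  "signed_sum v \<alpha> J T = (\<Sum>i\<in>J. (sign_on T i * sin (\<alpha> i)) *\<^sub>R v i)"

text \<open>The sign pattern is the set of indices that carry the sign \<open>+\<close>. The vector \<open>u\<close> is not
  normalized, so that Bang's argument can supply it directly; a norm below \<open>1\<close> is what makes the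
  inequality strict there.\<close>
definition avoids_with_signs ::
    "('i \<Rightarrow> 'a::real_inner) \<Rightarrow> ('i \<Rightarrow> real) \<Rightarrow> 'i set \<Rightarrow> 'i set \<Rightarrow> 'a \<Rightarrow> bool" where
  "avoids_with_signs v \<alpha> J T u \<longleftrightarrow>
     (\<forall>i\<in>J. norm u * sin (\<alpha> i) < sign_on T i * (u \<bullet> v i))"

lemma sign_on_mult_self: "sign_on T i * sign_on T i = 1"
  by (simp add: sign_on_def)

lemma signed_sum_remove:
  assumes "finite J" "i \<in> J"
  shows "signed_sum v \<alpha> J T =
    (sign_on T i * sin (\<alpha> i)) *\<^sub>R v i + signed_sum v \<alpha> (J - {i}) T"
  using assms by (simp add: signed_sum_def sum.remove)

lemma signed_sum_flip:
  assumes J: "finite J" "i \<in> J"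
  shows "\<exists>T'\<subseteq>insert i T. signed_sum v \<alpha> J T' =
    signed_sum v \<alpha> J T - (2 * sign_on T i * sin (\<alpha> i)) *\<^sub>R v i"
proof -
  define T' where "T' = (if i \<in> T then T - {i} else insert i T)"
  have "sign_on T' i = - sign_on T i"
    by (simp add: T'_def sign_on_def)
  moreover have "signed_sum v \<alpha> (J - {i}) T' = signed_sum v \<alpha> (J - {i}) T"
    unfolding signed_sum_def by (rule sum.cong) (auto simp: T'_def sign_on_def)
  ultimately have "signed_sum v \<alpha> J T' =
      signed_sum v \<alpha> J T - (2 * sign_on T i * sin (\<alpha> i)) *\<^sub>R v i"
    by (simp add: signed_sum_remove[OF J] scaleR_left_distrib[symmetric] algebra_simps
        flip: scaleR_left_distrib scaleR_minus_left)
  moreover have "T' \<subseteq> insert i T"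
    by (auto simp: T'_def)
  ultimately show ?thesis
    by blast
qed

text \<open>Reversing the sign \<open>s\<close> of the \<open>i\<close>-th term of the longest translated sum \<open>u\<close> gives
  \<open>u - 2 s w\<^sub>i\<close>, which is not longer. Comparing squares yields \<open>s (u \<bullet> w\<^sub>i) \<ge> \<bar>w\<^sub>i\<bar>\<^sup>2\<close>, that is,
  \<open>s (u \<bullet> v\<^sub>i) \<ge> sin \<alpha>\<^sub>i\<close>.\<close>
lemma bang_offset:
  fixes v :: "'i \<Rightarrow> 'a::real_inner"
  assumes J: "finite J" and T: "T \<subseteq> J"
    and v: "\<And>i. i \<in> J \<Longrightarrow> norm (v i) = 1"
    and pos: "\<And>i. i \<in> J \<Longrightarrow> 0 < sin (\<alpha> i)"
    and far: "\<And>T'. T' \<subseteq> J \<Longrightarrow> norm (signed_sum v \<alpha> J T' + z) \<le> norm (signed_sum v \<alpha> J T + z)"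
    and small: "norm (signed_sum v \<alpha> J T + z) < 1"
  shows "avoids_with_signs v \<alpha> J T (signed_sum v \<alpha> J T + z)"
  unfolding avoids_with_signs_def
proof
  fix i assume i: "i \<in> J"
  define u where "u = signed_sum v \<alpha> J T + z"
  define s where "s = sign_on T i"
  define a where "a = sin (\<alpha> i)"
  obtain T' where T': "T' \<subseteq> insert i T"
    "signed_sum v \<alpha> J T' = signed_sum v \<alpha> J T - (2 * s * a) *\<^sub>R v i"
    using signed_sum_flip[OF J i] unfolding s_def a_def by blast
  have "norm (u - (2 * s * a) *\<^sub>R v i) \<le> norm u"
    using far[of T'] T' T i by (auto simp: u_def algebra_simps)
  then have "(u - (2 * s * a) *\<^sub>R v i) \<bullet> (u - (2 * s * a) *\<^sub>R v i) \<le> u \<bullet> u"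
    by (simp add: norm_le)
  moreover have "v i \<bullet> v i = 1"
    using v[OF i] by (simp add: dot_square_norm)
  ultimately have "4 * (s * a)\<^sup>2 \<le> 4 * (s * a * (u \<bullet> v i))"
    by (simp add: algebra_simps inner_commute power2_eq_square)
  then have "a * a \<le> a * (s * (u \<bullet> v i))"
    using sign_on_mult_self[of T i] by (simp add: s_def power2_eq_square algebra_simps)
  moreover have "a > 0"
    using pos[OF i] by (simp add: a_def)
  ultimately have "a \<le> s * (u \<bullet> v i)"
    by simp
  moreover have "norm u * a < a"
    using small \<open>a > 0\<close> by (simp add: u_def)
  ultimately show "norm (signed_sum v \<alpha> J T + z) * sin (\<alpha> i)
      < sign_on T i * ((signed_sum v \<alpha> J T + z) \<bullet> v i)"
    by (simp add: u_def s_def a_def)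
qed

text \<open>Write \<open>y\<close> for the sum with all signs positive. The translation by \<open>t e\<close>, where \<open>e\<close> is
  orthogonal to \<open>y\<close>, changes the squared norm of \<open>x\<close> to
  \<open>\<bar>x\<bar>\<^sup>2 + 2 t (x \<bullet> e) + \<bar>t e\<bar>\<^sup>2\<close>. The last term is common to all sums and the middle one
  vanishes for \<open>\<plusminus>y\<close>. As \<open>t\<close> grows from \<open>0\<close>, stop as soon as some sum with mixed signs reaches
  \<open>\<plusminus>y\<close>: it is then a longest translated sum, and Bang's argument applies to it. The hypothesis
  on \<open>T0\<close> ensures that this happens for some \<open>t < cos A\<close>, while the norm is still below \<open>1\<close>.
  If a sum with mixed signs is as long as \<open>y\<close> from the start, no translation is needed and a longest
  one among the sums with mixed signs will do.\<close>
lemma mixed_avoider_exists: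
  fixes v :: "'i \<Rightarrow> 'a::real_inner"
  assumes J: "finite J"
    and v: "\<And>i. i \<in> J \<Longrightarrow> norm (v i) = 1"
    and pos: "\<And>i. i \<in> J \<Longrightarrow> 0 < sin (\<alpha> i)"
    and A: "0 \<le> A" "A < pi / 2"
    and bound: "\<And>T. T \<subseteq> J \<Longrightarrow> norm (signed_sum v \<alpha> J T) \<le> sin A"
    and e: "norm e \<le> 1" "signed_sum v \<alpha> J J \<bullet> e = 0"
    and T0: "T0 \<subseteq> J" "T0 \<noteq> {}" "T0 \<noteq> J"
    and T0_far: "(norm (signed_sum v \<alpha> J J))\<^sup>2 <
       (norm (signed_sum v \<alpha> J T0))\<^sup>2 + 2 * cos A * (signed_sum v \<alpha> J T0 \<bullet> e)"
  shows "\<exists>T u. T \<subseteq> J \<and> T \<noteq> {} \<and> T \<noteq> J \<and> avoids_with_signs v \<alpha> J T u"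
proof -
  define x where "x T = signed_sum v \<alpha> J T" for T
  define y where "y = x J"
  define M where "M = {T. T \<subseteq> J \<and> T \<noteq> {} \<and> T \<noteq> J}"
  have finM: "finite M"
    unfolding M_def using J by (auto intro: finite_subset[of _ "Pow J"])
  have T0M: "T0 \<in> M"
    using T0 by (simp add: M_def)
  have x_empty: "x {} = - y"
    by (simp add: x_def y_def signed_sum_def sign_on_def flip: sum_negf)
  have cosA: "cos A > 0"
    using A by (intro cos_gt_zero_pi) auto
  have y_le: "(norm y)\<^sup>2 \<le> (sin A)\<^sup>2"
    using bound[of J] by (intro power_mono) (auto simp: y_def x_def)
  have finish: ?thesis if TM: "T \<in> M"
    and far: "\<And>T'. T' \<subseteq> J \<Longrightarrow> norm (x T' + z) \<le> norm (x T + z)"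
    and small: "norm (x T + z) < 1" for T z
  proof -
    have "avoids_with_signs v \<alpha> J T (x T + z)"
      unfolding x_def using TM far small
      by (intro bang_offset[OF J _ v pos]) (auto simp: M_def x_def)
    then show ?thesis
      using TM by (auto simp: M_def)
  qed
  show ?thesis
  proof (cases "\<exists>T\<in>M. norm y \<le> norm (x T)")
    case True
    then obtain T1 where T1: "T1 \<in> M" "norm y \<le> norm (x T1)"
      by blast
    have "\<exists>T\<in>M. \<forall>T'\<in>M. norm (x T') \<le> norm (x T)"
    proof -
      have "Max ((\<lambda>T. norm (x T)) ` M) \<in> (\<lambda>T. norm (x T)) ` M"
        using finM T0M by (intro Max_in) auto
      then obtain T where "T \<in> M" "norm (x T) = Max ((\<lambda>T. norm (x T)) ` M)"
        by auto
      then show ?thesis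
        using finM by (auto intro!: bexI[of _ T])
    qed
    then obtain T where T: "T \<in> M" and max: "\<And>T'. T' \<in> M \<Longrightarrow> norm (x T') \<le> norm (x T)"
      by blast
    have "norm (x T') \<le> norm (x T)" if "T' \<subseteq> J" for T'
    proof (cases "T' \<in> M")
      case False
      with that have "norm (x T') = norm y"
        using x_empty by (auto simp: M_def y_def)
      then show ?thesis
        using T1 max[of T1] by linarith
    qed (use max in auto)
    moreover have "sin A < 1"
      using sin_monotone_2pi[of A "pi / 2"] A by simp
    then have "norm (x T) < 1"
      using bound[of T] T by (auto simp: x_def M_def)
    ultimately show ?thesis
      using T by (intro finish[of T 0]) auto
  next
    case False
    then have short: "norm (x T) < norm y" if "T \<in> M" for T
      using that by (meson not_le)
    \<comment> \<open>For \<open>x T \<bullet> e > 0\<close>, \<open>h T\<close> is the value of \<open>t\<close> at which the translate of \<open>x T\<close> becomes as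
      long as the translates of \<open>y\<close> and \<open>- y\<close>.\<close>
    define h where "h T = ((norm y)\<^sup>2 - (norm (x T))\<^sup>2) / (2 * (x T \<bullet> e))" for T
    define P where "P = {T\<in>M. x T \<bullet> e > 0}"
    have gap: "(norm (x T))\<^sup>2 < (norm y)\<^sup>2" if "T \<in> M" for T
      using short[OF that] by (intro power_strict_mono) auto
    have "0 < 2 * cos A * (x T0 \<bullet> e)"
      using T0_far gap[OF T0M] by (simp add: x_def y_def)
    then have T0P: "T0 \<in> P"
      using cosA T0M by (auto simp: P_def zero_less_mult_iff)
    have finP: "finite P"
      using finM by (simp add: P_def)
    define t where "t = Min (h ` P)"
    have "t \<in> h ` P"
      unfolding t_def using finP T0P by (intro Min_in) auto
    then obtain T where T: "T \<in> P" "t = h T"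
      by blast
    have t_min: "t \<le> h T'" if "T' \<in> P" for T'
      unfolding t_def using finP that by simp
    have t_pos: "0 < t"
      using T gap[of T] by (auto simp: h_def P_def)
    have "h T0 < cos A"
      using T0_far T0P by (auto simp: h_def P_def x_def y_def field_simps)
    then have t_less: "t < cos A"
      using t_min[OF T0P] by linarith
    have sq: "(norm (x S + t *\<^sub>R e))\<^sup>2 = (norm (x S))\<^sup>2 + 2 * t * (x S \<bullet> e) + (norm (t *\<^sub>R e))\<^sup>2"
      for S
      unfolding power2_norm_eq_inner by (simp add: algebra_simps inner_commute)
    have eq: "(norm (x T + t *\<^sub>R e))\<^sup>2 = (norm y)\<^sup>2 + (norm (t *\<^sub>R e))\<^sup>2"
      unfolding sq using T by (auto simp: h_def P_def field_simps)
    have "(norm (x T' + t *\<^sub>R e))\<^sup>2 \<le> (norm y)\<^sup>2 + (norm (t *\<^sub>R e))\<^sup>2" if T': "T' \<subseteq> J" for T'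
    proof -
      consider "T' = J" | "T' = {}" | "T' \<in> P" | "T' \<in> M" "x T' \<bullet> e \<le> 0"
        using T' by (force simp: M_def P_def)
      then have "(norm (x T'))\<^sup>2 + 2 * t * (x T' \<bullet> e) \<le> (norm y)\<^sup>2"
      proof cases
        case 1
        then show ?thesis using e by (simp add: x_def y_def)
      next
        case 2
        then show ?thesis using e x_empty by (simp add: x_def y_def)
      next
        case 3
        then show ?thesis
          using t_min[OF 3] by (auto simp: h_def P_def field_simps)
      next
        case 4
        have "t * (x T' \<bullet> e) \<le> 0"
          using 4 t_pos by (simp add: mult_le_0_iff)
        then show ?thesis
          using gap[OF 4(1)] by linarith
      qed
      then show ?thesis
        unfolding sq by simp
    qed
    then have far: "norm (x T' + t *\<^sub>R e) \<le> norm (x T + t *\<^sub>R e)" if "T' \<subseteq> J" for T'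
      using that eq by (metis norm_ge_zero power2_le_imp_le)
    have "norm (t *\<^sub>R e) \<le> t"
      using e t_pos by simp
    then have "(norm (t *\<^sub>R e))\<^sup>2 < (cos A)\<^sup>2"
      using t_less by (intro power_strict_mono) auto
    then have "(norm (x T + t *\<^sub>R e))\<^sup>2 < (sin A)\<^sup>2 + (cos A)\<^sup>2"
      using y_le unfolding eq by linarith
    then have "(norm (x T + t *\<^sub>R e))\<^sup>2 < 1\<^sup>2"
      by simp
    then have "norm (x T + t *\<^sub>R e) < 1"
      by (rule power2_less_imp_less) simp
    then show ?thesis
      using T far by (intro finish[of T "t *\<^sub>R e"]) (auto simp: P_def)
  qed
qed

section \<open>The cap around the weighted sum of the centers\<close>

text \<open>Let \<open>\<phi>\<close> be the angle between \<open>y\<close> and \<open>v\<^sub>i\<close>, and flip the \<open>i\<close>-th sign of \<open>y\<close>. The vector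
  \<open>y - 2 w\<^sub>i\<close> has squared norm \<open>\<bar>y\<bar>\<^sup>2 - 4 \<bar>y\<bar> sin \<alpha>\<^sub>i cos \<phi> + 4 sin\<^sup>2 \<alpha>\<^sub>i\<close> and distance
  \<open>2 sin \<alpha>\<^sub>i sin \<phi>\<close> from the line through \<open>y\<close>. With \<open>e\<close> pointing away from that line, the
  condition for a mixed avoider becomes \<open>\<bar>y\<bar> cos \<phi> < cos A sin \<phi> + sin \<alpha>\<^sub>i\<close>. As \<open>\<bar>y\<bar> \<le> sin A\<close>,
  it follows from \<open>sin (A - \<phi>) < sin \<alpha>\<^sub>i\<close>, hence from \<open>\<phi> > A - \<alpha>\<^sub>i\<close>, if \<open>\<phi>\<close> is
  acute; if \<open>\<phi>\<close> is not acute or \<open>y = 0\<close>, it holds trivially.\<close>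
lemma cap_around_sum:
  fixes v :: "'i \<Rightarrow> 'a::real_inner"
  assumes J: "finite J" "J \<noteq> {}"
    and v: "\<And>i. i \<in> J \<Longrightarrow> norm (v i) = 1"
    and \<alpha>: "\<And>i. i \<in> J \<Longrightarrow> 0 < \<alpha> i" and A: "sum \<alpha> J < pi / 2"
    and bound: "\<And>T. T \<subseteq> J \<Longrightarrow> norm (signed_sum v \<alpha> J T) \<le> sin (sum \<alpha> J)"
    and nonsep: "\<And>T u. T \<subseteq> J \<Longrightarrow> avoids_with_signs v \<alpha> J T u \<Longrightarrow> T = {} \<or> T = J"
    and i: "i \<in> J"
  shows "signed_sum v \<alpha> J J \<noteq> 0 \<and>
    arccos (sgn (signed_sum v \<alpha> J J) \<bullet> v i) + \<alpha> i \<le> sum \<alpha> J"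
proof (rule ccontr)
  define y where "y = signed_sum v \<alpha> J J"
  define A where "A = sum \<alpha> J"
  \<comment> \<open>\<open>c\<close> and \<open>norm r\<close> are the cosine and the sine of the angle between \<open>y\<close> and \<open>v i\<close>. For
    \<open>y = 0\<close>, \<open>sgn y = 0\<close> gives \<open>c = 0\<close> and \<open>r = v i\<close>, and the computation below still applies.\<close>
  define c where "c = sgn y \<bullet> v i"
  define r where "r = v i - c *\<^sub>R sgn y"
  assume "\<not> (signed_sum v \<alpha> J J \<noteq> 0 \<and>
    arccos (sgn (signed_sum v \<alpha> J J) \<bullet> v i) + \<alpha> i \<le> sum \<alpha> J)"
  then have far: "y = 0 \<or> A < arccos c + \<alpha> i"
    by (auto simp: y_def A_def c_def)
  have \<alpha>_le: "\<alpha> j \<le> A" if "j \<in> J" for j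
    unfolding A_def using J \<alpha> that by (intro member_le_sum) (auto intro: less_imp_le)
  have sin_pos: "0 < sin (\<alpha> j)" if "j \<in> J" for j
    using \<alpha>[OF that] \<alpha>_le[OF that] assms(5) by (intro sin_gt_zero) (auto simp: A_def)
  have A_pos: "0 < A"
    using \<alpha>[OF i] \<alpha>_le[OF i] by linarith
  have A_less: "A < pi / 2"
    using assms(5) by (simp add: A_def)
  \<comment> \<open>Flipping the sign of the only cap would not make the signs mixed.\<close>
  have Jne: "J \<noteq> {i}"
  proof
    assume Ji: "J = {i}"
    have "y = sin (\<alpha> i) *\<^sub>R v i"
      unfolding y_def Ji by (simp add: signed_sum_def sign_on_def)
    then have "sgn y = v i" "y \<noteq> 0"
      using sin_pos[OF i] v[OF i] by (auto simp: sgn_div_norm)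
    then have "c = 1"
      using v[OF i] by (simp add: c_def dot_square_norm)
    then show False
      using far \<open>y \<noteq> 0\<close> by (simp add: A_def Ji)
  qed
  have r_orth: "y \<bullet> r = 0"
  proof -
    have "y \<bullet> sgn y = norm y"
      using norm_mult_inner_sgn[of y y]
      by (cases "y = 0") (simp_all add: inner_commute dot_square_norm power2_eq_square)
    then show ?thesis
      using norm_mult_inner_sgn[of y "v i"]
      by (simp add: r_def c_def inner_diff_right mult.commute)
  qed
  have vi1: "v i \<bullet> v i = 1"
    using v[OF i] by (simp add: dot_square_norm)
  have r_v: "v i \<bullet> r = r \<bullet> r"
  proof -
    have "sgn y \<bullet> r = 0"
      using r_orth by (simp add: sgn_div_norm)
    then show ?thesis
      by (simp add: r_def inner_diff_left)
  qed
  have key: "norm y * c < cos A * norm r + sin (\<alpha> i)"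
  proof (cases "y = 0")
    case True
    then show ?thesis
      using sin_pos[OF i] A_pos A_less cos_gt_zero_pi[of A] by (simp add: add_nonneg_pos)
  next
    case False
    then have ny: "norm (sgn y) = 1"
      by (simp add: norm_sgn)
    note cb = inner_unit_bounds[OF ny v[OF i], folded c_def]
    have rr: "norm r = sqrt (1 - c\<^sup>2)"
      using norm_orthogonal_part[OF ny v[OF i]] by (simp add: r_def c_def)
    have cA: "cos A > 0"
      using A_pos A_less by (intro cos_gt_zero_pi) auto
    show ?thesis
    proof (cases "c \<le> 0")
      case True
      then have "norm y * c \<le> 0"
        by (simp add: mult_le_0_iff)
      moreover have "0 \<le> cos A * norm r"
        using cA by simp
      ultimately show ?thesis
        using sin_pos[OF i] by linarith
    next
      case c: False
      define f where "f = arccos c"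
      have f: "0 \<le> f" "f \<le> pi / 2" "cos f = c" "sin f = norm r"
        using cb c arccos_le_pi2[of c] by (auto simp: f_def rr sin_arccos arccos_lbound)
      have "A - f < \<alpha> i"
        using far False by (auto simp: f_def)
      then have "sin (A - f) < sin (\<alpha> i)"
        using f A_pos A_less \<alpha>_le[OF i] by (intro sin_monotone_2pi) auto
      moreover have "norm y * c \<le> sin A * c"
        using bound[of J] c by (intro mult_right_mono) (auto simp: y_def A_def)
      ultimately show ?thesis
        using f by (simp add: sin_diff)
    qed
  qed
  define e where "e = - sgn r"
  have x: "signed_sum v \<alpha> J (J - {i}) = y - (2 * sin (\<alpha> i)) *\<^sub>R v i"
  proof -
    have "signed_sum v \<alpha> (J - {i}) (J - {i}) = signed_sum v \<alpha> (J - {i}) J"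
      unfolding signed_sum_def by (rule sum.cong) (auto simp: sign_on_def)
    moreover have "(2 * sin (\<alpha> i)) *\<^sub>R v i = sin (\<alpha> i) *\<^sub>R v i + sin (\<alpha> i) *\<^sub>R v i"
      by (simp flip: scaleR_left_distrib)
    ultimately show ?thesis
      using i by (simp add: y_def signed_sum_remove[OF J(1) i] sign_on_def)
  qed
  have ye: "y \<bullet> e = 0"
    using r_orth by (simp add: e_def sgn_div_norm)
  have "v i \<bullet> sgn r = norm r"
    by (cases "r = 0") (simp_all add: sgn_div_norm r_v dot_square_norm power2_eq_square)
  then have xe: "(y - (2 * sin (\<alpha> i)) *\<^sub>R v i) \<bullet> e = 2 * sin (\<alpha> i) * norm r"
    using ye by (simp add: inner_diff_left) (simp add: e_def)
  have "y \<bullet> v i = norm y * c"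
    by (simp add: c_def norm_mult_inner_sgn)
  then have xx: "(norm (y - (2 * sin (\<alpha> i)) *\<^sub>R v i))\<^sup>2
      = (norm y)\<^sup>2 - 4 * sin (\<alpha> i) * (norm y * c) + 4 * (sin (\<alpha> i))\<^sup>2"
    unfolding power2_norm_eq_inner using vi1
    by (simp add: algebra_simps inner_commute power2_eq_square)
  have "sin (\<alpha> i) * (norm y * c) < sin (\<alpha> i) * (cos A * norm r + sin (\<alpha> i))"
    using key sin_pos[OF i] by simp
  then have "(norm y)\<^sup>2 < (norm (y - (2 * sin (\<alpha> i)) *\<^sub>R v i))\<^sup>2
      + 2 * cos A * ((y - (2 * sin (\<alpha> i)) *\<^sub>R v i) \<bullet> e)"
    unfolding xx xe by (simp add: algebra_simps power2_eq_square)
  then have "\<exists>T u. T \<subseteq> J \<and> T \<noteq> {} \<and> T \<noteq> J \<and> avoids_with_signs v \<alpha> J T u"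
    using A_pos A_less bound ye i Jne
    by (intro mixed_avoider_exists[OF J(1) v sin_pos, where A = A and e = e and ?T0.0 = "J - {i}"])
      (auto simp: x A_def e_def norm_sgn simp flip: y_def)
  then show False
    using nonsep by blast
qed

section \<open>Merging a minimal family with a long signed sum\<close>

text \<open>In a triangle with sides \<open>X\<close> and \<open>sin \<alpha>\<close> enclosing an angle with cosine \<open>c\<close>, the squared
  third side is the left-hand side of \<open>le\<close>. A triangle with angles \<open>\<alpha>\<close>, \<open>A - \<alpha>\<close>, \<open>\<pi> - A\<close>
  and circumscribed circle of diameter \<open>1\<close> has the sides \<open>sin \<alpha>\<close>, \<open>sin (A - \<alpha>)\<close>, \<open>sin A\<close>.
  Lengthening the side \<open>sin A\<close> without lengthening the side \<open>sin (A - \<alpha>)\<close>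
  forces the angle opposite to the latter to be at most \<open>A - \<alpha>\<close>.\<close>
lemma long_side_angle:
  fixes X c :: real
  assumes \<alpha>: "0 \<le> \<alpha>" "\<alpha> \<le> A" "A < pi / 2" and X: "sin A < X"
    and s: "0 < sin \<alpha>"
    and le: "X\<^sup>2 + (sin \<alpha>)\<^sup>2 - 2 * X * sin \<alpha> * c \<le> (sin (A - \<alpha>))\<^sup>2"
  shows "cos (A - \<alpha>) \<le> c"
proof (rule ccontr)
  define B where "B = A - \<alpha>"
  assume "\<not> cos (A - \<alpha>) \<le> c"
  then have less: "c < cos B"
    by (simp add: B_def)
  have "sin A = sin (\<alpha> + B)"
    by (simp add: B_def)
  then have sA: "sin A - sin \<alpha> * cos B = cos \<alpha> * sin B"
    by (simp add: sin_add)
  have "0 \<le> sin A"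
    using \<alpha> by (intro sin_ge_zero) auto
  have nn: "0 \<le> cos \<alpha> * sin B"
    using \<alpha> by (intro mult_nonneg_nonneg cos_ge_zero sin_ge_zero) (auto simp: B_def)
  have "(sin B)\<^sup>2 = (cos \<alpha> * sin B)\<^sup>2 + (sin \<alpha>)\<^sup>2 * (sin B)\<^sup>2"
    by (simp add: power_mult_distrib cos_squared_eq algebra_simps)
  also have "\<dots> = (cos \<alpha> * sin B)\<^sup>2 + (sin \<alpha>)\<^sup>2 * (1 - (cos B)\<^sup>2)"
    by (simp add: sin_squared_eq)
  also have "\<dots> \<le> (X - sin \<alpha> * cos B)\<^sup>2 + (sin \<alpha>)\<^sup>2 * (1 - (cos B)\<^sup>2)"
    using nn X by (intro add_right_mono power_mono) (auto simp flip: sA)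
  also have "\<dots> = X\<^sup>2 + (sin \<alpha>)\<^sup>2 - 2 * X * sin \<alpha> * cos B"
    by (simp add: power2_eq_square algebra_simps)
  also have "\<dots> < X\<^sup>2 + (sin \<alpha>)\<^sup>2 - 2 * X * sin \<alpha> * c"
    using less X s \<open>0 \<le> sin A\<close> by simp
  finally show False
    using le by (simp add: B_def)
qed

text \<open>The signed sum \<open>x\<close>, its \<open>i\<close>-th term \<open>s w\<^sub>i\<close> and the difference \<open>x - s w\<^sub>i\<close> form a triangle
  to which \<open>long_side_angle\<close> applies: \<open>x\<close> is long, whereas \<open>x - s w\<^sub>i\<close> is a signed sum over the
  remaining indices, hence short.\<close>
lemma minimal_long_sum_cap:
  fixes v :: "'i \<Rightarrow> 'a::real_inner"
  assumes I: "finite I" "i \<in> I"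
    and v: "\<And>i. i \<in> I \<Longrightarrow> norm (v i) = 1"
    and \<alpha>: "\<And>i. i \<in> I \<Longrightarrow> 0 < \<alpha> i" and A: "sum \<alpha> I < pi / 2"
    and long: "sin (sum \<alpha> I) < norm (signed_sum v \<alpha> I T)"
    and short: "norm (signed_sum v \<alpha> (I - {i}) T) \<le> sin (sum \<alpha> (I - {i}))"
  shows "arccos (sgn (signed_sum v \<alpha> I T) \<bullet> (sign_on T i *\<^sub>R v i)) + \<alpha> i \<le> sum \<alpha> I"
proof -
  define y where "y = signed_sum v \<alpha> I T"
  define A where "A = sum \<alpha> I"
  define w where "w = sign_on T i *\<^sub>R v i"
  define c where "c = sgn y \<bullet> w"
  have \<alpha>_le: "\<alpha> i \<le> A"
    unfolding A_def using I \<alpha> by (intro member_le_sum) (auto intro: less_imp_le)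
  have \<alpha>i: "0 < \<alpha> i"
    using \<alpha> I by blast
  have A_less: "A < pi / 2"
    using assms(5) by (simp add: A_def)
  have "0 \<le> sin A"
    using \<alpha>_le \<alpha>i A_less by (intro sin_ge_zero) auto
  then have "y \<noteq> 0"
    using long by (auto simp: y_def A_def)
  then have ny: "norm (sgn y) = 1"
    by (simp add: norm_sgn)
  have nw: "norm w = 1"
    using v[OF I(2)] by (simp add: w_def sign_on_def)
  note cb = inner_unit_bounds[OF ny nw, folded c_def]
  have "signed_sum v \<alpha> (I - {i}) T = y - sin (\<alpha> i) *\<^sub>R w"
    unfolding y_def w_def using signed_sum_remove[OF I, of v \<alpha> T] by (simp add: mult.commute)
  moreover have "sum \<alpha> (I - {i}) = A - \<alpha> i"
    using I by (simp add: A_def sum_diff1)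
  ultimately have "(norm (y - sin (\<alpha> i) *\<^sub>R w))\<^sup>2 \<le> (sin (A - \<alpha> i))\<^sup>2"
    using short by (intro power_mono) auto
  moreover have "y \<bullet> w = norm y * c"
    by (simp add: c_def norm_mult_inner_sgn)
  moreover have "w \<bullet> w = 1"
    using nw by (simp add: dot_square_norm)
  ultimately have "(norm y)\<^sup>2 + (sin (\<alpha> i))\<^sup>2 - 2 * norm y * sin (\<alpha> i) * c \<le> (sin (A - \<alpha> i))\<^sup>2"
    unfolding power2_norm_eq_inner by (simp add: algebra_simps inner_commute power2_eq_square)
  then have "cos (A - \<alpha> i) \<le> c"
    using \<alpha>i \<alpha>_le A_less cb long
    by (intro long_side_angle[of "\<alpha> i" A "norm y" c] sin_gt_zero) (auto simp: y_def A_def)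
  then have "arccos c \<le> arccos (cos (A - \<alpha> i))"
    using cb by (intro arccos_le_arccos) auto
  also have "\<dots> = A - \<alpha> i"
    using \<alpha>i \<alpha>_le A_less by (intro arccos_cos) auto
  finally show ?thesis
    by (simp add: c_def A_def w_def y_def)
qed

text \<open>The whole sign pattern may be reversed without changing the length of the sum. This is used to
  give the sign \<open>+\<close> to at least one index of \<open>I\<close>, which can then stand for the merged cap.\<close>
lemma minimal_long_subfamily:
  fixes v :: "'i \<Rightarrow> 'a::real_inner"
  assumes J: "finite J" and T0: "sin (sum \<alpha> J) < norm (signed_sum v \<alpha> J T0)"
  obtains I T where "I \<subseteq> J" "I \<inter> T \<noteq> {}"
    "sin (sum \<alpha> I) < norm (signed_sum v \<alpha> I T)"
    "\<And>i. i \<in> I \<Longrightarrow> norm (signed_sum v \<alpha> (I - {i}) T) \<le> sin (sum \<alpha> (I - {i}))"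
proof -
  define long where "long I \<longleftrightarrow> I \<subseteq> J \<and> (\<exists>T. sin (sum \<alpha> I) < norm (signed_sum v \<alpha> I T))" for I
  have "long J"
    using T0 by (auto simp: long_def)
  then obtain I where I: "long I" and min: "\<And>I'. long I' \<Longrightarrow> card I \<le> card I'"
    using ex_has_least_nat[of long J card] by blast
  then obtain T where T: "sin (sum \<alpha> I) < norm (signed_sum v \<alpha> I T)"
    by (auto simp: long_def)
  have IJ: "I \<subseteq> J" and finI: "finite I"
    using I J by (auto simp: long_def intro: finite_subset)
  have short: "norm (signed_sum v \<alpha> (I - {i}) S) \<le> sin (sum \<alpha> (I - {i}))" if "i \<in> I" for i S
  proof (rule ccontr)
    assume "\<not> norm (signed_sum v \<alpha> (I - {i}) S) \<le> sin (sum \<alpha> (I - {i}))"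
    then have "long (I - {i})"
      using IJ by (auto simp: long_def not_le)
    then show False
      using min[of "I - {i}"] finI that card_Diff1_less[of I i] by auto
  qed
  have "I \<noteq> {}"
    using T by (auto simp: signed_sum_def)
  have "signed_sum v \<alpha> I (- T) = - signed_sum v \<alpha> I T"
    unfolding signed_sum_def sum_negf[symmetric] by (rule sum.cong) (auto simp: sign_on_def)
  then have T': "sin (sum \<alpha> I) < norm (signed_sum v \<alpha> I (- T))"
    using T by simp
  have "I \<inter> T \<noteq> {} \<or> I \<inter> (- T) \<noteq> {}"
    using \<open>I \<noteq> {}\<close> by blast
  then show ?thesis
    using that[of I T] that[of I "- T"] IJ T T' short by blast
qed

section \<open>Non-separable families of centers and radii\<close>

text \<open>The statement about centers and radii, in a form that allows merging: the index \<open>k\<close> of one of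
  the merged caps takes over the new center and the total radius. Every sign pattern of an avoiding
  vector of the merged family lifts to one of the original family, with the signs of the merged
  caps as prescribed by \<open>T\<close> relative to the sign of \<open>k\<close>.\<close>
lemma nonseparable_centers_cap:
  fixes v :: "'i \<Rightarrow> 'a::real_inner"
  assumes "finite J" "J \<noteq> {}"
    and "\<And>i. i \<in> J \<Longrightarrow> norm (v i) = 1"
    and "\<And>i. i \<in> J \<Longrightarrow> 0 < \<alpha> i" and "sum \<alpha> J < pi / 2"
    and "\<And>T u. T \<subseteq> J \<Longrightarrow> avoids_with_signs v \<alpha> J T u \<Longrightarrow> T = {} \<or> T = J"
  shows "\<exists>p. norm p = 1 \<and> (\<forall>i\<in>J. arccos (p \<bullet> v i) + \<alpha> i \<le> sum \<alpha> J)"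
  using assms
proof (induction "card J" arbitrary: J v \<alpha> rule: less_induct)
  case less
  note J = less.prems(1,2) and v = less.prems(3) and \<alpha> = less.prems(4)
    and A = less.prems(5) and nonsep = less.prems(6)
  show ?case
  proof (cases "\<forall>T\<subseteq>J. norm (signed_sum v \<alpha> J T) \<le> sin (sum \<alpha> J)")
    case True
    have *: "signed_sum v \<alpha> J J \<noteq> 0 \<and>
      arccos (sgn (signed_sum v \<alpha> J J) \<bullet> v i) + \<alpha> i \<le> sum \<alpha> J" if "i \<in> J" for i
      using True by (intro cap_around_sum[OF J v \<alpha> A _ nonsep that]) auto
    then show ?thesis
      using J by (intro exI[of _ "sgn (signed_sum v \<alpha> J J)"]) (auto simp: norm_sgn)
  next
    case False
    then obtain T0 where "sin (sum \<alpha> J) < norm (signed_sum v \<alpha> J T0)"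
      by (auto simp: not_le)
    then obtain I T where IJ: "I \<subseteq> J" and IT: "I \<inter> T \<noteq> {}"
      and long: "sin (sum \<alpha> I) < norm (signed_sum v \<alpha> I T)"
      and short: "\<And>i. i \<in> I \<Longrightarrow> norm (signed_sum v \<alpha> (I - {i}) T) \<le> sin (sum \<alpha> (I - {i}))"
      using minimal_long_subfamily[OF J(1)] by blast
    from IT obtain k where k: "k \<in> I" "k \<in> T"
      by blast
    have finI: "finite I"
      using IJ J finite_subset by blast
    have sub_sum: "sum \<alpha> I + sum \<alpha> (J - I) = sum \<alpha> J"
      using sum.subset_diff[OF IJ J(1), of \<alpha>] by simp
    have "0 \<le> sum \<alpha> (J - I)"
      using \<alpha> by (intro sum_nonneg) (auto intro: less_imp_le)
    then have AI: "sum \<alpha> I < pi / 2"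
      using sub_sum A by linarith
    have AI_pos: "0 < sum \<alpha> I"
      using \<alpha> IJ k finI by (intro sum_pos) auto
    define y where "y = signed_sum v \<alpha> I T"
    have "0 \<le> sin (sum \<alpha> I)"
      using AI AI_pos by (intro sin_ge_zero) auto
    then have "y \<noteq> 0"
      using long by (auto simp: y_def)
    then have ny: "norm (sgn y) = 1"
      by (simp add: norm_sgn)
    have merged: "arccos (sgn y \<bullet> (sign_on T i *\<^sub>R v i)) + \<alpha> i \<le> sum \<alpha> I" if "i \<in> I" for i
      unfolding y_def using IJ that AI long short[OF that] v \<alpha>
      by (intro minimal_long_sum_cap[OF finI that]) auto
    define J' where "J' = insert k (J - I)"
    define v' where "v' = v(k := sgn y)"
    define \<alpha>' where "\<alpha>' = \<alpha>(k := sum \<alpha> I)"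
    have kJ: "k \<notin> J - I"
      using k by blast
    have "sum \<alpha>' (J - I) = sum \<alpha> (J - I)"
      using kJ by (intro sum.cong) (auto simp: \<alpha>'_def)
    then have sum': "sum \<alpha>' J' = sum \<alpha> J"
      using J kJ sub_sum by (simp add: J'_def \<alpha>'_def)
    have "I \<noteq> {k}"
    proof
      assume "I = {k}"
      then have "norm (signed_sum v \<alpha> I T) = \<bar>sin (\<alpha> k)\<bar>"
        using v k IJ by (simp add: signed_sum_def sign_on_def)
      then show False
        using long \<open>0 \<le> sin (sum \<alpha> I)\<close> by (simp add: \<open>I = {k}\<close>)
    qed
    then have "J' \<subset> J"
      using k IJ by (auto simp: J'_def)
    then have card': "card J' < card J"
      using J by (simp add: psubset_card_mono)
    define lift where "lift T' = (T' - {k}) \<union> (if k \<in> T' then I \<inter> T else I - T)" for T'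
    have lift: "avoids_with_signs v \<alpha> J (lift T') u"
      if T': "T' \<subseteq> J'" and u: "avoids_with_signs v' \<alpha>' J' T' u" for T' u
      unfolding avoids_with_signs_def
    proof
      fix i assume i: "i \<in> J"
      show "norm u * sin (\<alpha> i) < sign_on (lift T') i * (u \<bullet> v i)"
      proof (cases "i \<in> I")
        case False
        then have "i \<in> J'" "i \<noteq> k"
          using i k by (auto simp: J'_def)
        then have "norm u * sin (\<alpha> i) < sign_on T' i * (u \<bullet> v i)"
          using u by (auto simp: avoids_with_signs_def v'_def \<alpha>'_def dest!: bspec[of _ _ i])
        moreover have "sign_on (lift T') i = sign_on T' i"
          using False \<open>i \<noteq> k\<close> by (auto simp: lift_def sign_on_def)
        ultimately show ?thesis
          by simp
      next
        case True
        define s where "s = sign_on T' k"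
        have s: "s = 1 \<or> s = - 1"
          by (simp add: s_def sign_on_def)
        have "norm u * sin (sum \<alpha> I) < s * (u \<bullet> sgn y)"
          using u by (auto simp: avoids_with_signs_def v'_def \<alpha>'_def J'_def s_def)
        then have su: "norm (s *\<^sub>R u) * sin (sum \<alpha> I) < (s *\<^sub>R u) \<bullet> sgn y"
          using s by auto
        have "norm (s *\<^sub>R u) * sin (\<alpha> i) < (s *\<^sub>R u) \<bullet> (sign_on T i *\<^sub>R v i)"
        proof (rule avoid_larger_cap[OF ny _ merged[OF True] _ AI su])
          show "norm (sign_on T i *\<^sub>R v i) = 1"
            using v[OF i] by (simp add: sign_on_def)
          show "0 \<le> \<alpha> i"
            using \<alpha>[OF i] by simp
        qed
        moreover have "sign_on (lift T') i = s * sign_on T i"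
          using True T' by (auto simp: lift_def sign_on_def s_def J'_def)
        ultimately show ?thesis
          by (simp add: s_def sign_on_def split: if_splits)
      qed
    qed
    have lift_sub: "lift T' \<subseteq> J" if "T' \<subseteq> J'" for T'
      using that IJ by (auto simp: lift_def J'_def)
    have nonsep': "T' = {} \<or> T' = J'" if T': "T' \<subseteq> J'" and u: "avoids_with_signs v' \<alpha>' J' T' u"
      for T' u
    proof -
      have "lift T' = {} \<or> lift T' = J"
        using nonsep[OF lift_sub[OF T'] lift[OF T' u]] .
      moreover have "k \<in> lift T' \<longleftrightarrow> k \<in> T'"
        using k by (auto simp: lift_def)
      moreover have "T' - {k} = lift T' - I"
        using k T' by (auto simp: lift_def J'_def)
      moreover have "k \<in> J"
        using k IJ by blast
      ultimately show ?thesis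
        using T' by (cases "k \<in> T'") (auto simp: J'_def)
    qed
    have "\<exists>p. norm p = 1 \<and> (\<forall>i\<in>J'. arccos (p \<bullet> v' i) + \<alpha>' i \<le> sum \<alpha>' J')"
    proof (rule less.hyps[OF card'])
      show "norm (v' i) = 1" "0 < \<alpha>' i" if "i \<in> J'" for i
        using that ny v \<alpha> AI_pos by (auto simp: v'_def \<alpha>'_def J'_def)
    qed (use J nonsep' A sum' in \<open>auto simp: J'_def\<close>)
    then obtain p where p: "norm p = 1"
      and cover: "\<And>i. i \<in> J' \<Longrightarrow> arccos (p \<bullet> v' i) + \<alpha>' i \<le> sum \<alpha> J"
      unfolding sum' by blast
    \<comment> \<open>All points of the covering cap have positive inner product with its center \<open>p\<close>, as
      \<open>sum \<alpha> J < pi / 2\<close>. Hence \<open>p\<close> is itself an avoiding vector, and lifting its signs shows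
      that no cap was reflected.\<close>
    have "avoids_with_signs v' \<alpha>' J' J' p"
      unfolding avoids_with_signs_def
    proof
      fix i assume i: "i \<in> J'"
      have "norm (v' i) = 1" "0 < \<alpha>' i"
        using i ny v \<alpha> AI_pos by (auto simp: v'_def \<alpha>'_def J'_def)
      moreover have "sin (sum \<alpha> J) < 1"
        using A AI_pos sub_sum \<open>0 \<le> sum \<alpha> (J - I)\<close> sin_monotone_2pi[of "sum \<alpha> J" "pi / 2"] by simp
      then have "norm p * sin (sum \<alpha> J) < p \<bullet> p"
        using p by (simp add: dot_square_norm)
      ultimately have "norm p * sin (\<alpha>' i) < p \<bullet> v' i"
        using avoid_larger_cap[OF p _ cover[OF i] _ A] by simp
      then show "norm p * sin (\<alpha>' i) < sign_on J' i * (p \<bullet> v' i)"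
        using i by (simp add: sign_on_def)
    qed
    then have "lift J' = {} \<or> lift J' = J"
      using nonsep[OF lift_sub lift] by blast
    moreover have "k \<in> lift J'"
      using k by (auto simp: lift_def J'_def)
    ultimately have "lift J' = J"
      by blast
    then have all_plus: "I \<subseteq> T"
      using IJ by (auto simp: lift_def J'_def split: if_splits)
    have "arccos (p \<bullet> v i) + \<alpha> i \<le> sum \<alpha> J" if i: "i \<in> J" for i
    proof (cases "i \<in> I")
      case True
      then have "sign_on T i = 1"
        using all_plus by (auto simp: sign_on_def)
      then have "arccos (sgn y \<bullet> v i) + \<alpha> i \<le> sum \<alpha> I"
        using merged[OF True] by simp
      moreover have "arccos (p \<bullet> sgn y) + sum \<alpha> I \<le> sum \<alpha> J"
        using cover[of k] by (simp add: J'_def v'_def \<alpha>'_def)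
      ultimately show ?thesis
        using arccos_inner_triangle[OF p ny v[OF i]] by linarith
    next
      case False
      then have "i \<noteq> k" "i \<in> J'"
        using i k by (auto simp: J'_def)
      then show ?thesis
        using cover[of i] by (simp add: v'_def \<alpha>'_def)
    qed
    then show ?thesis
      using p by blast
  qed
qed

section \<open>From caps to centers and radii\<close>

lemma great_sphere_orthogonal:
  fixes u :: "'a::euclidean_space"
  assumes "u \<noteq> 0"
  shows "great_sphere {x \<in> sphere 0 1. u \<bullet> x = 0}"
proof -
  have "dim {x. u \<bullet> x = 0} + 1 = DIM('a)"
    using dim_hyperplane[OF assms] DIM_positive[where 'a = 'a] by simp
  then show ?thesis
    unfolding great_sphere_def
    by (intro exI[of _ "{x. u \<bullet> x = 0}"]) (auto simp: subspace_hyperplane)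
qed

lemma cap_in_open_hemisphere:
  fixes u v x :: "'a::euclidean_space"
  assumes "norm v = 1" "norm x = 1" "spherical_dist v x \<le> a" "a < pi / 2"
    and "norm u * sin a < u \<bullet> v"
  shows "0 < u \<bullet> x"
  using avoid_larger_cap[of v x 0 a u] assms by (simp add: spherical_dist_def)

theorem theorem2:
  fixes d n :: nat
    and C :: "nat \<Rightarrow> 'a::euclidean_space set"
    and \<alpha> :: "nat \<Rightarrow> real"
  assumes "d \<ge> 1" and "DIM('a) = d + 1"
    and "n \<ge> 1"
    and "\<And>i. i \<in> {1..n} \<Longrightarrow> \<alpha> i > 0"
    and "\<And>i. i \<in> {1..n} \<Longrightarrow> is_cap (\<alpha> i) (C i)"
    and "non_separable (C ` {1..n})"
    and "(\<Sum>i=1..n. \<alpha> i) < pi / 2"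
  shows "\<exists>K. is_cap (\<Sum>i=1..n. \<alpha> i) K \<and> (\<forall>i\<in>{1..n}. C i \<subseteq> K)"
proof -
  define J where "J = {1..n}"
  define A where "A = sum \<alpha> J"
  have J: "finite J" "J \<noteq> {}"
    using assms(3) by (auto simp: J_def)
  have \<alpha>: "0 < \<alpha> i" if "i \<in> J" for i
    using assms(4) that by (simp add: J_def)
  have \<alpha>_less: "\<alpha> i < pi / 2" if "i \<in> J" for i
    using member_le_sum[of i J \<alpha>] that J \<alpha> assms(7) by (force simp: J_def)
  have "\<forall>i\<in>J. \<exists>c. norm c = 1 \<and> C i = {x \<in> sphere 0 1. spherical_dist c x \<le> \<alpha> i}"
    using assms(5) by (fastforce simp: J_def is_cap_def)
  then obtain v where v: "\<And>i. i \<in> J \<Longrightarrow> norm (v i) = 1"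
    and C: "\<And>i. i \<in> J \<Longrightarrow> C i = {x \<in> sphere 0 1. spherical_dist (v i) x \<le> \<alpha> i}"
    by metis
  have "T = {} \<or> T = J" if T: "T \<subseteq> J" and u: "avoids_with_signs v \<alpha> J T u" for T u
  proof (rule ccontr)
    assume "\<not> (T = {} \<or> T = J)"
    then obtain i j where i: "i \<in> T" and j: "j \<in> J" "j \<notin> T"
      using T by blast
    define P N where "P = {x \<in> sphere 0 1. u \<bullet> x > 0}" and "N = {x \<in> sphere 0 1. u \<bullet> x < 0}"
    have "u \<noteq> 0"
      using u J by (auto simp: avoids_with_signs_def)
    have plus: "C l \<subseteq> P" if "l \<in> T" for l
    proof
      fix x assume x: "x \<in> C l"
      have l: "l \<in> J"
        using T that by blast
      have "norm u * sin (\<alpha> l) < u \<bullet> v l"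
        using u T that by (auto simp: avoids_with_signs_def sign_on_def dest!: bspec[of _ _ l])
      then have "0 < u \<bullet> x"
        using x C[OF l] by (intro cap_in_open_hemisphere[OF v[OF l] _ _ \<alpha>_less[OF l]]) auto
      then show "x \<in> P"
        using x l by (auto simp: C P_def)
    qed
    have minus: "C l \<subseteq> N" if "l \<in> J" "l \<notin> T" for l
    proof
      fix x assume x: "x \<in> C l"
      have "norm (- u) * sin (\<alpha> l) < (- u) \<bullet> v l"
        using u that by (auto simp: avoids_with_signs_def sign_on_def dest!: bspec[of _ _ l])
      then have "0 < (- u) \<bullet> x"
        using x C[OF that(1)]
        by (intro cap_in_open_hemisphere[OF v[OF that(1)] _ _ \<alpha>_less[OF that(1)]]) auto
      then show "x \<in> N"
        using x that by (auto simp: C N_def)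
    qed
    define G where "G = {x \<in> sphere 0 1. u \<bullet> x = 0}"
    have "G \<inter> C l = {}" if "l \<in> J" for l
      using plus[of l] minus[of l] that by (cases "l \<in> T") (auto simp: G_def P_def N_def)
    then have "avoiding G (C ` J)"
      using great_sphere_orthogonal[OF \<open>u \<noteq> 0\<close>] by (auto simp: avoiding_def G_def)
    moreover have "open_hemispheres_bounded_by G P N"
      unfolding open_hemispheres_bounded_by_def using \<open>u \<noteq> 0\<close>
      by (intro exI[of _ u]) (simp add: G_def P_def N_def)
    ultimately show False
      using assms(6) plus[OF i] minus[OF j] i j T unfolding non_separable_def J_def by blast
  qed
  then have "\<exists>p. norm p = 1 \<and> (\<forall>i\<in>J. arccos (p \<bullet> v i) + \<alpha> i \<le> A)"
    unfolding A_def using assms(7)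
    by (intro nonseparable_centers_cap[OF J v \<alpha>]) (auto simp: J_def)
  then obtain p where p: "norm p = 1" and cover: "\<And>i. i \<in> J \<Longrightarrow> arccos (p \<bullet> v i) + \<alpha> i \<le> A"
    by blast
  define K where "K = {x \<in> sphere 0 1. spherical_dist p x \<le> A}"
  have "C i \<subseteq> K" if i: "i \<in> J" for i
  proof
    fix x assume "x \<in> C i"
    then have x: "norm x = 1" "arccos (v i \<bullet> x) \<le> \<alpha> i"
      using C[OF i] by (auto simp: spherical_dist_def)
    then show "x \<in> K"
      using arccos_inner_triangle[OF p v[OF i] x(1)] cover[OF i]
      by (simp add: K_def spherical_dist_def)
  qed
  moreover have "is_cap A K"
    using p by (auto simp: is_cap_def K_def)
  ultimately show ?thesis
    unfolding A_def J_def by blast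
qed

end
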